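(* Let $n\ge 1$, $\varepsilon\in(0,1)$ and $\delta\in(0,1]$. Consider a masked action sequence $a^{\mathrm{safe}}_{1:n}$ produced by the X-Safe action masking safeguard (described in the context) from candidate actions $a_{1:n}$, where for each $i=1,\dots,n$ the safeguard computes, at the state $s_i$, a random polytope $\mathcal{P}_{s_i}\subset\mathbb{R}^{d}$, and suppose that the flag $\mathtt{passed}$ is true for all $n$ actions, so that every $\mathcal{P}_{s_i}$ is a certified safe polytope, i.e. it satisfies the single-step guarantee $$\mathbb{P}\left[\frac{\mathrm{vol}(\mathcal{P}_{s_i}\setminus\mathcal{C}^{\mathrm{safe}}_{s_i})}{\mathrm{vol}(\mathcal{P}_{s_i})}>\varepsilon\right]\le\delta ,\qquad i=1,\dots,n.$$ Then $$\mathbb{P}\left[\frac{\sum_{i=1}^n \mathrm{vol}(\mathcal{P}_{s_i}\setminus\mathcal{C}^{\mathrm{safe}}_{s_i})}{\sum_{i=1}^n \mathrm{vol}(\mathcal{P}_{s_i})}>\varepsilon\right]\le n\,\delta .$$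
   Context: Setting. $d$ is the number of degrees of freedom of a robotic manipulator, and configurations $q$ lie in $\mathbb{R}^{d}$. A safety-relevant state is a pair $s=(q,s^{\mathrm{env}})\in\mathcal{S}$ consisting of the current configuration $q$ and a scene description $s^{\mathrm{env}}$. A violation function $C:\mathcal{S}\to\{0,1\}$ has value $1$ exactly when the state is in collision. Actions are changes of configuration lying in a state-dependent action set $\mathcal{A}(s)\subset\mathbb{R}^{d}$ (bounded by a maximum joint difference). The true safe set at $s=(q,s^{\mathrm{env}})$ is $\mathcal{C}^{\mathrm{safe}}_s=\{a\in\mathcal{A}(s) : C((q+a,s^{\mathrm{env}}))=0\}$. An action and the configuration it leads to are identified by translation by the current configuration, so that $\mathcal{P}_s$ and $\mathcal{C}^{\mathrm{safe}}_s$ are viewed as (measurable) subsets of the same space $\mathbb{R}^d$. $\mathrm{vol}$ denotes Lebesgue measure on $\mathbb{R}^d$; the polytopes are bounded and have positive volume, so that the ratios are defined. Safe polytope computation. At a state $s$ with configuration $q$ and candidate action $a$, a randomized iterative procedure starts with $\mathcal{P}$ equal to a box domain $\mathcal{D}\subset\mathbb{R}^d$. In each of at most $N_{\mathrm{iter}}$ iterations it samples $M$ points uniformly from $\mathcal{P}$ (together with some extra points near $q$ and the target), tests them for collision with $C$, and applies a statistical test to the number of colliding points. If the test passes, the procedure stops and returns $\mathcal{P}_s=\mathcal{P}$ with $\mathtt{passed}=\mathrm{True}$. Otherwise it cuts $\mathcal{P}$ with additional hyperplanes separating $q$ from colliding samples and continues. If the test never passes, it returns the last $\mathcal{P}$ with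 $\mathtt{passed}=\mathrm{False}$. Probabilities are over the randomness of this sampling (and of everything it induces, in particular the random states $s_i$). Here $\varepsilon$ is the admissible volume fraction in collision, $\delta$ the confidence parameter, $\tau$ a decision threshold of the test, and the number of samples satisfies $M\ge 2\log(1/\delta)/(\varepsilon\tau^2)$. A polytope returned with $\mathtt{passed}=\mathrm{True}$ is known (from earlier work, to be taken as given) to satisfy the single-step guarantee displayed in the claim. X-Safe action masking safeguard. Input: current configuration $q$, scene $s^{\mathrm{env}}$, candidate actions $a_1,\dots,a_n$. For $i=1,\dots,n$: let $s_i=(q,s^{\mathrm{env}})$ with the current value of $q$; compute $(\mathcal{P}_{s_i},\mathtt{passed})$ by the procedure above at $s_i$ with candidate action $a_i$. If $\mathtt{passed}$ is true, let $a_i^{\mathrm{safe}}$ be obtained from $a_i$ by ray masking: $a_i$ is left unchanged if $\mathcal{P}_{s_i}$ encloses the action set, or encloses it along the ray from $q$ through $a_i$; otherwise $a_i^{\mathrm{safe}}=q+\frac{\|q^{\mathcal{P}}-q\|}{\|q^{\mathcal{A}}-q\|}(a_i-q)$, where $q^{\mathcal{P}}$ and $q^{\mathcal{A}}$ are the points where this ray meets the boundary of $\mathcal{P}_{s_i}$ and of the action set (with actions written as target configurations). Then replace $q$ by the configuration $a_i^{\mathrm{safe}}$ and continue. (If $\mathtt{passed}$ is false, a fallback controller supplies the remaining actions; this case is excluded in the claim.) *)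

theory Defs
  imports "HOL-Probability.Probability"
begin

(* A state is a pair of a configuration and a scene description. Elements of A s are changes of
   configuration; all other points and sets, including candidate actions, are given in
   configuration coordinates (an action is identified with the configuration it leads to). *)

type_synonym ('d, 'e) state = "(real ^ 'd) \<times> 'e"

definition safe_set ::
  "(('d::finite, 'e) state \<Rightarrow> nat) \<Rightarrow> (('d, 'e) state \<Rightarrow> (real ^ 'd) set)
    \<Rightarrow> ('d, 'e) state \<Rightarrow> (real ^ 'd) set"
  where "safe_set C A s = {a \<in> A s. C (fst s + a, snd s) = 0}"

definition to_configs :: "('d::finite, 'e) state \<Rightarrow> (real ^ 'd) set \<Rightarrow> (real ^ 'd) set"
  where "to_configs s X = (\<lambda>a. fst s + a) ` X"

definition colliding ::
  "(('d::finite, 'e) state \<Rightarrow> nat) \<Rightarrow> 'e \<Rightarrow> (real ^ 'd) list \<Rightarrow> (real ^ 'd) list"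
  where "colliding C env xs = filter (\<lambda>x. C (x, env) = 1) xs"

(* The possible outcomes (polytope, passed) of the randomized iteration with k iterations left
   and current polytope P. xs are the m samples drawn from P, ys the extra points within
   distance \<rho> of the current configuration or of the target t. The statistical test is a
   parameter; it sees the number of colliding points of either kind, so that it may count the
   extra points or ignore them. The law of the samples is not part of this relation: it belongs
   to the probability space on which the outcomes are random. *)
inductive polytope_iteration ::
  "(('d::finite, 'e) state \<Rightarrow> nat) \<Rightarrow> (nat \<Rightarrow> nat \<Rightarrow> bool) \<Rightarrow> nat \<Rightarrow> real
    \<Rightarrow> ('d, 'e) state \<Rightarrow> real ^ 'd
    \<Rightarrow> nat \<Rightarrow> (real ^ 'd) set \<Rightarrow> (real ^ 'd) set \<Rightarrow> bool \<Rightarrow> bool"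
  for C test m \<rho> s t where
  exhausted: "polytope_iteration C test m \<rho> s t 0 P P False"
| accept:
    "\<lbrakk>length xs = m; set xs \<subseteq> P; set ys \<subseteq> ball (fst s) \<rho> \<union> ball t \<rho>;
      test (length (colliding C (snd s) xs)) (length (colliding C (snd s) ys))\<rbrakk>
     \<Longrightarrow> polytope_iteration C test m \<rho> s t (Suc k) P P True"
| cut:
    "\<lbrakk>length xs = m; set xs \<subseteq> P; set ys \<subseteq> ball (fst s) \<rho> \<union> ball t \<rho>;
      \<not> test (length (colliding C (snd s) xs)) (length (colliding C (snd s) ys));
      finite H;
      \<forall>(h, c) \<in> H. h \<noteq> 0 \<and> h \<bullet> fst s \<le> c
        \<and> (\<exists>x \<in> set (colliding C (snd s) (xs @ ys)). c \<le> h \<bullet> x);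
      polytope_iteration C test m \<rho> s t k (P \<inter> (\<Inter>(h, c) \<in> H. {x. h \<bullet> x \<le> c})) P' passed\<rbrakk>
     \<Longrightarrow> polytope_iteration C test m \<rho> s t (Suc k) P P' passed"

lemma polytope_iteration_polytope:
  assumes "polytope_iteration C test m \<rho> s t k P P' passed" and "polytope P"
  shows "polytope P'"
  using assms
proof (induction rule: polytope_iteration.induct)
  case (cut xs P ys H k P' passed)
  have "polyhedron (\<Inter>(h, c) \<in> H. {x. h \<bullet> x \<le> c})"
    using cut.hyps by (intro polyhedron_Inter) (auto simp: polyhedron_halfspace_le)
  then show ?case
    using cut by (simp add: polytope_Int_polyhedron)
qed auto

definition ray :: "real ^ 'd::finite \<Rightarrow> real ^ 'd \<Rightarrow> (real ^ 'd) set"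
  where "ray q a = {q + r *\<^sub>R (a - q) | r. 0 \<le> r}"

(* B is the action set in configuration coordinates. A relation, since the ray may meet the
   frontier of a general set in several points; for convex sets with q in their interior
   the points qP and qA are unique. *)
definition ray_masked ::
  "(real ^ 'd::finite) set \<Rightarrow> (real ^ 'd) set \<Rightarrow> real ^ 'd \<Rightarrow> real ^ 'd \<Rightarrow> real ^ 'd \<Rightarrow> bool"
  where "ray_masked P B q a a' \<longleftrightarrow>
    (if B \<subseteq> P \<or> B \<inter> ray q a \<subseteq> P then a' = a
     else \<exists>qP \<in> ray q a \<inter> frontier P. \<exists>qA \<in> ray q a \<inter> frontier B.
       qA \<noteq> q \<and> a' = q + (norm (qP - q) / norm (qA - q)) *\<^sub>R (a - q))"

(* A single realization of the safeguard: D is the box domain, N the maximal number of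
   iterations, a the candidate actions, q i the configuration at the start of step i, and
   asafe the masked actions. Nothing is required after a step that has not passed, as the
   fallback controller takes over there. *)
definition xsafe_run ::
  "(('d::finite, 'e) state \<Rightarrow> nat) \<Rightarrow> (('d, 'e) state \<Rightarrow> (real ^ 'd) set)
    \<Rightarrow> (real ^ 'd) set \<Rightarrow> nat \<Rightarrow> (nat \<Rightarrow> nat \<Rightarrow> bool) \<Rightarrow> nat \<Rightarrow> real
    \<Rightarrow> nat \<Rightarrow> real ^ 'd \<Rightarrow> 'e \<Rightarrow> (nat \<Rightarrow> real ^ 'd)
    \<Rightarrow> (nat \<Rightarrow> real ^ 'd) \<Rightarrow> (nat \<Rightarrow> (real ^ 'd) set) \<Rightarrow> (nat \<Rightarrow> bool) \<Rightarrow> (nat \<Rightarrow> real ^ 'd)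
    \<Rightarrow> bool"
  where "xsafe_run C A D N test m \<rho> n q0 env a q P passed asafe \<longleftrightarrow>
    q 1 = q0 \<and>
    (\<forall>i \<in> {1..n}. (\<forall>j \<in> {1..<i}. passed j) \<longrightarrow>
      polytope_iteration C test m \<rho> (q i, env) (a i) N D (P i) (passed i) \<and>
      (passed i \<longrightarrow>
        ray_masked (P i) (to_configs (q i, env) (A (q i, env))) (q i) (a i) (asafe i) \<and>
        q (Suc i) = asafe i))"

definition vol :: "(real ^ 'd::finite) set \<Rightarrow> real"
  where "vol = measure lebesgue"

definition unsafe_part ::
  "(('d::finite, 'e) state \<Rightarrow> nat) \<Rightarrow> (('d, 'e) state \<Rightarrow> (real ^ 'd) set)
    \<Rightarrow> ('d, 'e) state \<Rightarrow> (real ^ 'd) set \<Rightarrow> (real ^ 'd) set"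
  where "unsafe_part C A s P = P - to_configs s (safe_set C A s)"

end

(* The ratio of the sums is a mediant (a weighted mean) of the individual ratios, so it can exceed
   \<epsilon> only if some individual ratio does; a union bound over the n steps finishes the proof.
   No independence of the steps is involved. *)
theory Submission
  imports Defs
begin

text \<open>By contraposition: if every ratio is at most \<open>\<epsilon>\<close>, the positive
  denominators can be cleared term by term, and the resulting linear inequalities add up.\<close>

lemma exists_ratio_gt_if_ratio_of_sums_gt:
  fixes u v :: "'i \<Rightarrow> 'a::linordered_field"
  assumes "finite I" "I \<noteq> {}" and pos: "\<And>i. i \<in> I \<Longrightarrow> 0 < v i"
    and gt: "sum u I / sum v I > \<epsilon>"
  shows "\<exists>i\<in>I. u i / v i > \<epsilon>"
proof (rule ccontr)
  assume "\<not> ?thesis"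
  then have "u i \<le> \<epsilon> * v i" if "i \<in> I" for i
    using that pos[OF that] by (auto simp: not_less pos_divide_le_eq)
  then have "sum u I \<le> \<epsilon> * sum v I"
    by (simp add: sum_distrib_left sum_mono)
  \<comment> \<open>Strictness comes from \<open>I \<noteq> {}\<close>: over an empty index set the
    quotient would be 0 / 0 = 0, which exceeds any negative \<open>\<epsilon>\<close>.\<close>
  moreover have "0 < sum v I"
    using assms by (intro sum_pos) auto
  ultimately show False
    using gt by (simp add: pos_less_divide_eq)
qed

text \<open>The previous lemma, applied at each outcome, covers the event for the sums by the events
  for the single indices, up to the null set where some denominator fails to be positive. Finite
  subadditivity does the rest.\<close>

lemma (in finite_measure) measure_ratio_of_sums_gt_le:
  fixes u v :: "'i \<Rightarrow> 'a \<Rightarrow> real"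
  assumes I: "finite I" "I \<noteq> {}"
    and pos: "AE \<omega> in M. \<forall>i\<in>I. 0 < v i \<omega>"
    and [measurable]: "\<And>i. i \<in> I \<Longrightarrow> u i \<in> borel_measurable M"
      "\<And>i. i \<in> I \<Longrightarrow> v i \<in> borel_measurable M"
  shows "measure M {\<omega> \<in> space M. (\<Sum>i\<in>I. u i \<omega>) / (\<Sum>i\<in>I. v i \<omega>) > \<epsilon>}
    \<le> (\<Sum>i\<in>I. measure M {\<omega> \<in> space M. u i \<omega> / v i \<omega> > \<epsilon>})"
proof -
  let ?E = "\<lambda>i. {\<omega> \<in> space M. u i \<omega> / v i \<omega> > \<epsilon>}"
  have E: "?E i \<in> sets M" if "i \<in> I" for i
    using that by measurable
  have "measure M {\<omega> \<in> space M. (\<Sum>i\<in>I. u i \<omega>) / (\<Sum>i\<in>I. v i \<omega>) > \<epsilon>} \<le> measure M (\<Union>i\<in>I. ?E i)"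
  \<comment> \<open>The almost sure form of monotonicity absorbs that null set; it asks for
    measurability of the larger event, the union.\<close>
  proof (rule finite_measure_mono_AE)
    show "AE \<omega> in M. \<omega> \<in> {\<omega> \<in> space M. (\<Sum>i\<in>I. u i \<omega>) / (\<Sum>i\<in>I. v i \<omega>) > \<epsilon>} \<longrightarrow> \<omega> \<in> (\<Union>i\<in>I. ?E i)"
      using pos
    proof eventually_elim
      case (elim \<omega>)
      then show ?case
        using exists_ratio_gt_if_ratio_of_sums_gt[OF I, of "\<lambda>i. v i \<omega>" \<epsilon> "\<lambda>i. u i \<omega>"] by blast
    qed
    show "(\<Union>i\<in>I. ?E i) \<in> sets M"
      using I E by (intro sets.finite_UN)
  qed
  also have "\<dots> \<le> (\<Sum>i\<in>I. measure M (?E i))"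
    using I E by (intro finite_measure_subadditive_finite) auto
  finally show ?thesis .
qed

text \<open>All steps live on one space \<open>\<Omega>\<close>, so \<open>q i\<close> is random and
  each bound in \<open>single_step\<close> is a marginal one that also averages over the sampling of
  the earlier steps; a union bound needs just such marginals. \<open>safe_set_measurable\<close>
  keeps \<open>vol\<close> of an unsafe part from being the default 0 of a non-measurable
  set.\<close>

theorem proposition2:
  fixes \<Omega> :: "'w measure"
    and C :: "('d::finite, 'e) state \<Rightarrow> nat"
    and A :: "('d, 'e) state \<Rightarrow> (real ^ 'd) set"
    and \<Delta> lo hi q0 :: "real ^ 'd" and env :: 'e
    and test :: "real \<Rightarrow> nat \<Rightarrow> nat \<Rightarrow> bool"
    and N m n :: nat and \<epsilon> \<delta> \<tau> \<rho> :: real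
    and a q asafe :: "nat \<Rightarrow> 'w \<Rightarrow> real ^ 'd"
    and P :: "nat \<Rightarrow> 'w \<Rightarrow> (real ^ 'd) set"
    and passed :: "nat \<Rightarrow> 'w \<Rightarrow> bool"
  assumes "prob_space \<Omega>"
    and "1 \<le> n" and "0 < \<epsilon>" and "\<epsilon> < 1" and "0 < \<delta>" and "\<delta> \<le> 1" and "0 < \<tau>"
    and samples: "real m \<ge> 2 * ln (1 / \<delta>) / (\<epsilon> * \<tau>\<^sup>2)"
    and violation: "\<And>s. C s \<in> {0, 1}"
    and max_joint_diff: "\<And>s x j. x \<in> A s \<Longrightarrow> \<bar>x $ j\<bar> \<le> \<Delta> $ j"
    and safe_set_measurable: "\<And>x. safe_set C A (x, env) \<in> sets lebesgue"
    and run: "AE \<omega> in \<Omega>. xsafe_run C A (cbox lo hi) N (test \<tau>) m \<rho> n q0 env (\<lambda>i. a i \<omega>)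
           (\<lambda>i. q i \<omega>) (\<lambda>i. P i \<omega>) (\<lambda>i. passed i \<omega>) (\<lambda>i. asafe i \<omega>)"
    and all_passed: "AE \<omega> in \<Omega>. \<forall>i \<in> {1..n}. passed i \<omega>"
    and vol_pos: "AE \<omega> in \<Omega>. \<forall>i \<in> {1..n}. 0 < vol (P i \<omega>)"
    and vol_measurable: "\<And>i. i \<in> {1..n} \<Longrightarrow> (\<lambda>\<omega>. vol (P i \<omega>)) \<in> borel_measurable \<Omega>"
    and unsafe_vol_measurable: "\<And>i. i \<in> {1..n} \<Longrightarrow>
           (\<lambda>\<omega>. vol (unsafe_part C A (q i \<omega>, env) (P i \<omega>))) \<in> borel_measurable \<Omega>"
    and single_step: "\<And>i. i \<in> {1..n} \<Longrightarrow>
           measure \<Omega> {\<omega> \<in> space \<Omega>.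
             vol (unsafe_part C A (q i \<omega>, env) (P i \<omega>)) / vol (P i \<omega>) > \<epsilon>} \<le> \<delta>"
  shows "measure \<Omega> {\<omega> \<in> space \<Omega>.
           (\<Sum>i = 1..n. vol (unsafe_part C A (q i \<omega>, env) (P i \<omega>))) /
           (\<Sum>i = 1..n. vol (P i \<omega>)) > \<epsilon>} \<le> real n * \<delta>"
proof -
  interpret prob_space \<Omega> by fact
  let ?u = "\<lambda>i \<omega>. vol (unsafe_part C A (q i \<omega>, env) (P i \<omega>))"
  \<comment> \<open>Here \<open>1 \<le> n\<close> serves to make the index set \<open>{1..n}\<close>
    nonempty.\<close>
  have "measure \<Omega> {\<omega> \<in> space \<Omega>. (\<Sum>i = 1..n. ?u i \<omega>) / (\<Sum>i = 1..n. vol (P i \<omega>)) > \<epsilon>}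
      \<le> (\<Sum>i = 1..n. measure \<Omega> {\<omega> \<in> space \<Omega>. ?u i \<omega> / vol (P i \<omega>) > \<epsilon>})"
    using \<open>1 \<le> n\<close> vol_pos vol_measurable unsafe_vol_measurable
    by (intro measure_ratio_of_sums_gt_le) simp_all
  also have "\<dots> \<le> (\<Sum>i = 1..n. \<delta>)"
    by (intro sum_mono single_step)
  finally show ?thesis by simp
qed

end
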